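(* Let $\mathbb K$ be a field, $X$ a set, and fix a monomial order on $\langle X\rangle$. Let $F\subseteq\mathbb K\langle X\rangle$, let $G\subseteq(F)$, where $(F)$ is the two-sided ideal generated by $F$, and let $f\in\mathbb K\langle X\rangle$ be such that $f\overset{*}{\to}_G0$. Then, for all labelled quivers $Q$ with labels in $X$ such that all elements of $G$ are both $Q$-consequences of $F$ and $Q$-order compatible, we have \[ f\text{ is compatible with }Q \iff f\text{ is a }Q\text{-consequence of }F. \]
   Context: $\mathbb K\langle X\rangle$ is the free associative $\mathbb K$-algebra on $X$; $\langle X\rangle$ is the set of monomials, i.e. words over $X$ including the empty word $1$; $\operatorname{supp}(f)$ is the set of monomials with nonzero coefficient in $f$. A monomial order is a well-founded total order on $\langle X\rangle$ compatible with multiplication; $\operatorname{LM}(f)$ is the leading (largest) monomial of a nonzero polynomial $f$. A labelled quiver with labels in $X$ is $Q=(V,E,X,s,t,l)$ with $V$ a set of vertices, $E$ a set of edges, source and target maps $s,t:E\to V$ and a label function $l:E\to X$ (not necessarily injective). A nonempty path is $p=e_n\cdots e_1$ with $s(e_{i+1})=t(e_i)$; $s(p)=s(e_1)$, $t(p)=t(e_n)$, $l(p)=l(e_n)\cdots l(e_1)\in\langle X\rangle$. For each vertex $v$ there is an empty path $\epsilon_v$ from $v$ to $v$ with $l(\epsilon_v)=1$. Signatures: for a monomial $m$, $\sigma(m)=\{(s(p),t(p)) \mid p \text{ a path in } Q \text{ with } l(p)=m\}\subseteq V\times V$; for a polynomial $f$, $\sigma(f)=\bigcap_{m\in\operatorname{supp}(f)}\sigma(m)$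 (so $\sigma(0)=V\times V$). $f$ is compatible with $Q$ if $\sigma(f)\neq\emptyset$. A compatible (nonzero) polynomial $f$ is $Q$-order compatible if $\sigma(\operatorname{LM}(f))=\sigma(f)$. A $Q$-consequence of $F\subseteq \mathbb K\langle X\rangle$ is a polynomial $f\in \mathbb K\langle X\rangle$, compatible with $Q$, such that there exist finitely many $g_i\in F$, $a_i,b_i\in \mathbb K\langle X\rangle$, $1\le i\le n$, with $f=\sum_{i=1}^n a_ig_ib_i$ (the empty sum being $0$) and such that for every $(u,v)\in\sigma(f)$ and every $i$ there exist vertices $u_i,v_i$ with $(u,u_i)\in\sigma(b_i)$, $(u_i,v_i)\in\sigma(g_i)$ and $(v_i,v)\in\sigma(a_i)$. Standard polynomial reduction: $f\to_G h$ if there are $g\in G$ and monomials $a,b$ with $a\operatorname{LM}(g)b\in\operatorname{supp}(f)$ and $h=f+\lambda agb$, where $\lambda\in\mathbb K$ is chosen such that the monomial $a\operatorname{LM}(g)b$ is cancelled in $h$. $\overset{*}{\to}_G$ is the reflexive transitive closure of $\to_G$. *)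

theory Defs
  imports "HOL-Library.Poly_Mapping" "HOL.Hull" "Graph_Theory.Arc_Walk"
begin

section \<open>The free algebra\<close>

text \<open>
  Words over an alphabet \<open>'x\<close> are lists, and the additive notation that \<open>Poly_Mapping\<close> uses for
  the exponent monoid is concatenation. Hence \<open>'x list \<Rightarrow>\<^sub>0 'k\<close> with its library
  multiplication is the free associative algebra on \<open>'x\<close>, its unit being the empty word.
\<close>

instantiation list :: (type) monoid_add
begin

definition zero_list :: "'a list" where "zero_list = []"

definition plus_list :: "'a list \<Rightarrow> 'a list \<Rightarrow> 'a list" where "plus_list = append"

instance
  by standard (simp_all add: zero_list_def plus_list_def)

end

type_synonym ('x, 'k) free_algebra = "'x list \<Rightarrow>\<^sub>0 'k"

definition monom :: "'x list \<Rightarrow> ('x, 'k::field) free_algebra" where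
  "monom m = Poly_Mapping.single m 1"

definition scalar :: "'k \<Rightarrow> ('x, 'k::field) free_algebra" where
  "scalar c = Poly_Mapping.single [] c"

abbreviation supp :: "('x, 'k::field) free_algebra \<Rightarrow> 'x list set" where
  "supp \<equiv> Poly_Mapping.keys"

definition two_sided_ideal :: "('x, 'k::field) free_algebra set \<Rightarrow> bool" where
  "two_sided_ideal I \<longleftrightarrow>
     0 \<in> I \<and> (\<forall>p\<in>I. \<forall>q\<in>I. p + q \<in> I) \<and> (\<forall>p\<in>I. \<forall>a. a * p \<in> I \<and> p * a \<in> I)"

definition ideal_gen :: "('x, 'k::field) free_algebra set \<Rightarrow> ('x, 'k) free_algebra set" where
  "ideal_gen F = two_sided_ideal hull F"

section \<open>Monomial orders and reduction\<close>

text \<open>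
  \<open>(u, v) \<in> r\<close> means that \<open>u\<close> is at most \<open>v\<close>; \<open>well_order\<close> says that \<open>r\<close> is a total order whose
  strict part is well-founded. As words can be cancelled, compatibility of the strict part with
  multiplication is equivalent to that of \<open>r\<close>.
\<close>

definition monomial_order :: "'x list rel \<Rightarrow> bool" where
  "monomial_order r \<longleftrightarrow>
     well_order r \<and> (\<forall>a b u v. (u, v) \<in> r \<longrightarrow> (a @ u @ b, a @ v @ b) \<in> r)"

text \<open>Only meaningful for nonzero polynomials.\<close>

definition LM :: "'x list rel \<Rightarrow> ('x, 'k::field) free_algebra \<Rightarrow> 'x list" where
  "LM r f = (THE m. m \<in> supp f \<and> (\<forall>m'\<in>supp f. (m', m) \<in> r))"

definition red_step ::
  "'x list rel \<Rightarrow> ('x, 'k::field) free_algebra set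
    \<Rightarrow> ('x, 'k) free_algebra \<Rightarrow> ('x, 'k) free_algebra \<Rightarrow> bool" where
  "red_step r G f h \<longleftrightarrow>
     (\<exists>g\<in>G. \<exists>a b c. g \<noteq> 0 \<and> a @ LM r g @ b \<in> supp f \<and>
        h = f + scalar c * (monom a * g * monom b) \<and> a @ LM r g @ b \<notin> supp h)"

abbreviation reduces ::
  "'x list rel \<Rightarrow> ('x, 'k::field) free_algebra set
    \<Rightarrow> ('x, 'k) free_algebra \<Rightarrow> ('x, 'k) free_algebra \<Rightarrow> bool" where
  "reduces r G \<equiv> (red_step r G)\<^sup>*\<^sup>*"

section \<open>Labelled quivers and signatures\<close>

text \<open>
  A labelled quiver is a directed multigraph \<open>Q\<close> with \<open>wf_digraph Q\<close> (\<open>tail\<close> being the source map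
  and \<open>head\<close> the target map) together with a label function \<open>l\<close>.
  A walk \<open>[e\<^sub>1, \<dots>, e\<^sub>n]\<close> lists its arcs in the order in which they are traversed, whereas the
  corresponding path is written \<open>e\<^sub>n \<cdots> e\<^sub>1\<close>; hence the reversal in the label of a path.
  The empty walk exists at every vertex of \<open>Q\<close>.
\<close>

definition path_label :: "('e \<Rightarrow> 'x) \<Rightarrow> 'e awalk \<Rightarrow> 'x list" where
  "path_label l p = rev (map l p)"

definition sig_mon :: "('v, 'e) pre_digraph \<Rightarrow> ('e \<Rightarrow> 'x) \<Rightarrow> 'x list \<Rightarrow> ('v \<times> 'v) set" where
  "sig_mon Q l m = {(u, v). \<exists>p. pre_digraph.awalk Q u p v \<and> path_label l p = m}"

definition sig ::
  "('v, 'e) pre_digraph \<Rightarrow> ('e \<Rightarrow> 'x) \<Rightarrow> ('x, 'k::field) free_algebra \<Rightarrow> ('v \<times> 'v) set" where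
  "sig Q l f = (verts Q \<times> verts Q) \<inter> (\<Inter>m\<in>supp f. sig_mon Q l m)"

definition compatible ::
  "('v, 'e) pre_digraph \<Rightarrow> ('e \<Rightarrow> 'x) \<Rightarrow> ('x, 'k::field) free_algebra \<Rightarrow> bool" where
  "compatible Q l f \<longleftrightarrow> sig Q l f \<noteq> {}"

definition order_compatible ::
  "'x list rel \<Rightarrow> ('v, 'e) pre_digraph \<Rightarrow> ('e \<Rightarrow> 'x) \<Rightarrow> ('x, 'k::field) free_algebra \<Rightarrow> bool" where
  "order_compatible r Q l f \<longleftrightarrow>
     f \<noteq> 0 \<and> compatible Q l f \<and> sig_mon Q l (LM r f) = sig Q l f"

definition Q_consequence ::
  "('v, 'e) pre_digraph \<Rightarrow> ('e \<Rightarrow> 'x) \<Rightarrow> ('x, 'k::field) free_algebra set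
    \<Rightarrow> ('x, 'k) free_algebra \<Rightarrow> bool" where
  "Q_consequence Q l F f \<longleftrightarrow> compatible Q l f \<and>
     (\<exists>(n::nat) g a b. (\<forall>i\<in>{1..n}. g i \<in> F) \<and> f = (\<Sum>i=1..n. a i * g i * b i) \<and>
        (\<forall>(u, v) \<in> sig Q l f. \<forall>i\<in>{1..n}. \<exists>u' v'.
           (u, u') \<in> sig Q l (b i) \<and> (u', v') \<in> sig Q l (g i) \<and> (v', v) \<in> sig Q l (a i)))"

end

theory Submission
  imports Defs
begin

text \<open>
  In a reduction step \<open>f \<rightarrow> h = f + c a g b\<close> the monomial \<open>a LM(g) b\<close> lies in the support of \<open>f\<close>,
  so every pair in \<open>\<sigma>(f)\<close> is joined by a path that factors through \<open>\<sigma>(LM(g)) = \<sigma>(g)\<close>.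
  Hence \<open>\<sigma>(f) \<subseteq> \<sigma>(h)\<close>, and substituting the representation of the \<open>Q\<close>-consequence \<open>g\<close> yields
  one of \<open>c a g b\<close> whose summands are all compatible with \<open>\<sigma>(f)\<close>. Adding these up along the
  reduction to \<open>0\<close> gives the required representation of \<open>f\<close>.
\<close>

context wf_digraph
begin

lemma sig_mon_verts: "(u, v) \<in> sig_mon G l m \<Longrightarrow> u \<in> verts G \<and> v \<in> verts G"
  by (auto simp: sig_mon_def dest: awalk_hd_in_verts awalk_last_in_verts)

lemma sig_mon_Nil: "sig_mon G l [] = Id_on (verts G)"
  by (auto simp: sig_mon_def path_label_def awalk_Nil_iff)

text \<open>Cutting a walk where its label splits yields the middle vertex. The factors swap because
  labels are written against the direction of traversal, whereas \<open>O\<close> composes along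
  it.\<close>

lemma sig_mon_append: "sig_mon G l (a @ b) = sig_mon G l b O sig_mon G l a"
proof (intro set_eqI iffI; clarify)
  fix u v assume "(u, v) \<in> sig_mon G l (a @ b)"
  then obtain p where p: "awalk u p v" "rev (map l p) = a @ b"
    by (auto simp: sig_mon_def path_label_def)
  then have "map l p = rev b @ rev a"
    by (metis rev_append rev_rev_ident)
  then obtain q s where "p = q @ s" "map l q = rev b" "map l s = rev a"
    by (auto simp: map_eq_append_conv)
  moreover from this p(1) obtain w where "awalk u q w" "awalk w s v"
    by auto
  ultimately have "(u, w) \<in> sig_mon G l b" "(w, v) \<in> sig_mon G l a"
    by (auto simp: sig_mon_def path_label_def)
  then show "(u, v) \<in> sig_mon G l b O sig_mon G l a"
    by blast
next
  fix u w v assume "(u, w) \<in> sig_mon G l b" "(w, v) \<in> sig_mon G l a"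
  then obtain p q where "awalk u p w" "rev (map l p) = b" "awalk w q v" "rev (map l q) = a"
    by (auto simp: sig_mon_def path_label_def)
  then show "(u, v) \<in> sig_mon G l (a @ b)"
    by (auto simp: sig_mon_def path_label_def intro!: exI[of _ "p @ q"])
qed

lemma sig_monom: "sig G l (monom m :: ('x, 'k::field) free_algebra) = sig_mon G l m"
  using sig_mon_verts by (fastforce simp: sig_def monom_def)

lemma sig_scalar: "v \<in> verts G \<Longrightarrow> (v, v) \<in> sig G l (scalar c)"
  by (auto simp: sig_def scalar_def sig_mon_Nil Id_on_def)

text \<open>Every monomial of the product concatenates one of \<open>p\<close> with one of
  \<open>q\<close>, and the single vertex \<open>w\<close> serves all these pairs. The converse
  fails, since different monomials may need different middle vertices.\<close>

lemma sig_mult: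
  assumes "(u, w) \<in> sig G l q" "(w, v) \<in> sig G l p"
  shows "(u, v) \<in> sig G l (p * q)"
proof -
  have "(u, v) \<in> sig_mon G l m" if m: "m \<in> supp (p * q)" for m
  proof -
    obtain a b where "m = a @ b" "a \<in> supp p" "b \<in> supp q"
      using subsetD[OF keys_mult m] by (auto simp: plus_list_def)
    then show ?thesis
      using assms by (auto simp: sig_def sig_mon_append)
  qed
  then show ?thesis
    using assms by (auto simp: sig_def)
qed

lemma sig_add: "sig G l p \<inter> sig G l q \<subseteq> sig G l (p + q)"
  using Poly_Mapping.keys_add[of p q] by (auto simp: sig_def)

end

text \<open>
  The path conditions refer to an arbitrary set \<open>S\<close> instead of \<open>\<sigma>(f)\<close>, since the signature of a
  partial sum of a representation is unrelated to that of the whole.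
\<close>

inductive rep_on ::
  "('v, 'e) pre_digraph \<Rightarrow> ('e \<Rightarrow> 'x) \<Rightarrow> ('x, 'k::field) free_algebra set
    \<Rightarrow> ('v \<times> 'v) set \<Rightarrow> ('x, 'k) free_algebra \<Rightarrow> bool"
  for Q l F S where
  rep_on_zero: "rep_on Q l F S 0"
| rep_on_step: "rep_on Q l F S f \<Longrightarrow> g \<in> F \<Longrightarrow> S \<subseteq> sig Q l b O sig Q l g O sig Q l a
    \<Longrightarrow> rep_on Q l F S (f + a * g * b)"

text \<open>Trades the indexed sums of \<open>Q_consequence\<close> for the inductive predicate, so
  that adding and substituting representations become rule inductions without any
  reindexing.\<close>

lemma rep_on_iff:
  fixes f :: "('x, 'k::field) free_algebra"
  shows "rep_on Q l F S f \<longleftrightarrow>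
    (\<exists>(n::nat) g a b. (\<forall>i\<in>{1..n}. g i \<in> F) \<and> f = (\<Sum>i=1..n. a i * g i * b i) \<and>
        (\<forall>(u, v) \<in> S. \<forall>i\<in>{1..n}. \<exists>u' v'.
           (u, u') \<in> sig Q l (b i) \<and> (u', v') \<in> sig Q l (g i) \<and> (v', v) \<in> sig Q l (a i)))"
proof -
  have paths: "(\<forall>(u, v) \<in> S. \<forall>i\<in>{1..n}. \<exists>u' v'.
      (u, u') \<in> sig Q l (b i) \<and> (u', v') \<in> sig Q l (g i) \<and> (v', v) \<in> sig Q l (a i)) \<longleftrightarrow>
    (\<forall>i\<in>{1..n}. S \<subseteq> sig Q l (b i) O sig Q l (g i) O sig Q l (a i))" for n :: nat
      and g a b :: "nat \<Rightarrow> ('x, 'k) free_algebra"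
    by (auto simp: relcomp_unfold subset_eq)
  show ?thesis
    unfolding paths
  proof
    assume "rep_on Q l F S f"
    then show "\<exists>(n::nat) g a b. (\<forall>i\<in>{1..n}. g i \<in> F) \<and> f = (\<Sum>i=1..n. a i * g i * b i) \<and>
        (\<forall>i\<in>{1..n}. S \<subseteq> sig Q l (b i) O sig Q l (g i) O sig Q l (a i))"
    proof induction
      case rep_on_zero
      show ?case by (rule exI[of _ 0]) simp
    next
      case (rep_on_step f g b a)
      then obtain n :: nat and g' a' b' where IH: "\<forall>i\<in>{1..n}. g' i \<in> F"
        "f = (\<Sum>i=1..n. a' i * g' i * b' i)"
        "\<forall>i\<in>{1..n}. S \<subseteq> sig Q l (b' i) O sig Q l (g' i) O sig Q l (a' i)"
        by blast
      let ?g = "g'(Suc n := g)" and ?a = "a'(Suc n := a)" and ?b = "b'(Suc n := b)"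
      have "\<forall>i\<in>{1..Suc n}. ?g i \<in> F"
        using IH(1) \<open>g \<in> F\<close> by auto
      moreover have "f + a * g * b = (\<Sum>i=1..Suc n. ?a i * ?g i * ?b i)"
        using IH(2) by simp
      moreover have "\<forall>i\<in>{1..Suc n}. S \<subseteq> sig Q l (?b i) O sig Q l (?g i) O sig Q l (?a i)"
        using IH(3) rep_on_step.hyps(3) by (simp add: atLeastAtMostSuc_conv)
      ultimately show ?case by blast
    qed
  next
    assume "\<exists>(n::nat) g a b. (\<forall>i\<in>{1..n}. g i \<in> F) \<and> f = (\<Sum>i=1..n. a i * g i * b i) \<and>
        (\<forall>i\<in>{1..n}. S \<subseteq> sig Q l (b i) O sig Q l (g i) O sig Q l (a i))"
    then obtain n :: nat and g a b where *: "\<forall>i\<in>{1..n}. g i \<in> F" "f = (\<Sum>i=1..n. a i * g i * b i)"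
        "\<forall>i\<in>{1..n}. S \<subseteq> sig Q l (b i) O sig Q l (g i) O sig Q l (a i)"
      by blast
    have "rep_on Q l F S (\<Sum>i=1..k. a i * g i * b i)" if "k \<le> n" for k
      using that
    proof (induction k)
      case 0
      show ?case by (simp add: rep_on_zero)
    next
      case (Suc k)
      then have "Suc k \<in> {1..n}" "rep_on Q l F S (\<Sum>i=1..k. a i * g i * b i)"
        by auto
      with * have "rep_on Q l F S ((\<Sum>i=1..k. a i * g i * b i) + a (Suc k) * g (Suc k) * b (Suc k))"
        by (blast intro: rep_on_step)
      then show ?case by simp
    qed
    then show "rep_on Q l F S f"
      using *(2) by blast
  qed
qed

lemma Q_consequence_iff_rep_on:
  "Q_consequence Q l F f \<longleftrightarrow> compatible Q l f \<and> rep_on Q l F (sig Q l f) f"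
  unfolding Q_consequence_def rep_on_iff ..

lemma rep_on_mono: "rep_on Q l F S f \<Longrightarrow> T \<subseteq> S \<Longrightarrow> rep_on Q l F T f"
  by (induction rule: rep_on.induct) (auto intro: rep_on.intros)

lemma rep_on_add:
  assumes "rep_on Q l F S g" "rep_on Q l F S f"
  shows "rep_on Q l F S (f + g)"
  using assms by (induction rule: rep_on.induct)
    (auto simp: add.assoc[symmetric] intro: rep_on.intros)

text \<open>Each summand \<open>a' * g * b'\<close> of \<open>f\<close> turns into
  \<open>(a * a') * g * (b' * b)\<close>, and \<open>sig_mult\<close> prolongs its paths at both
  ends.\<close>

lemma (in wf_digraph) rep_on_mult:
  assumes "rep_on G l F S f" "T \<subseteq> sig G l b O S O sig G l a"
  shows "rep_on G l F T (a * f * b)"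
  using assms(1)
proof induction
  case rep_on_zero
  show ?case by (simp add: rep_on.rep_on_zero)
next
  case (rep_on_step f g b' a')
  have "T \<subseteq> sig G l (b' * b) O sig G l g O sig G l (a * a')"
  proof clarify
    fix u v assume "(u, v) \<in> T"
    then obtain w x y z where "(u, w) \<in> sig G l b" "(w, y) \<in> sig G l b'" "(y, z) \<in> sig G l g"
      "(z, x) \<in> sig G l a'" "(x, v) \<in> sig G l a"
      using assms(2) rep_on_step.hyps(3) by blast
    then show "(u, v) \<in> sig G l (b' * b) O sig G l g O sig G l (a * a')"
      by (blast intro: sig_mult)
  qed
  from rep_on.rep_on_step[OF rep_on_step.IH rep_on_step.hyps(2) this] show ?case
    by (simp add: algebra_simps)
qed

text \<open>A path labelled \<open>a @ LM r g @ b\<close> splits into three, and order compatibility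
  lets its middle part count for all monomials of \<open>g\<close>. Scalars have every empty path in
  their signature, so the left cofactor can absorb \<open>c\<close>.\<close>

lemma (in wf_digraph) red_step_sig:
  assumes "order_compatible r G l g" and "a @ LM r g @ b \<in> supp f"
  shows "sig G l f \<subseteq> sig G l (monom b) O sig G l g O sig G l (scalar c * monom a)"
proof -
  have "sig G l f \<subseteq> sig_mon G l b O sig G l g O sig_mon G l a"
    using assms by (auto simp: sig_def[of _ _ f] order_compatible_def sig_mon_append O_assoc)
  moreover have "sig_mon G l a \<subseteq> sig G l (scalar c * monom a)"
    using sig_mon_verts by (auto intro!: sig_mult sig_scalar simp: sig_monom)
  ultimately show ?thesis
    unfolding sig_monom by blast
qed

lemma (in wf_digraph) reduces_zero_rep_on:
  fixes B :: "('x, 'k::field) free_algebra set"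
  assumes "reduces r B f 0"
    and "\<forall>g\<in>B. Q_consequence G l F g \<and> order_compatible r G l g"
  shows "rep_on G l F (sig G l f) f"
  using assms(1)
proof (induction rule: converse_rtranclp_induct)
  case base
  show ?case by (rule rep_on_zero)
next
  case (step f h)
  then obtain g a b c where g: "g \<in> B" "a @ LM r g @ b \<in> supp f"
    and h: "h = f + scalar c * (monom a * g * monom b)"
    by (auto simp: red_step_def)
  \<comment> \<open>The coefficient stays free because two values are used: \<open>c\<close> for the
    term that the reduction adds, \<open>- c\<close> for undoing it.\<close>
  have sub: "sig G l f \<subseteq> sig G l (monom b) O sig G l g O sig G l (scalar d * monom a)" for d :: 'k
    using red_step_sig g assms(2) by blast
  have "sig G l f \<subseteq> sig G l (scalar c * monom a * g * monom b)"
    using sub by (blast intro: sig_mult)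
  then have "sig G l f \<subseteq> sig G l h"
    using sig_add unfolding h by (fastforce simp: mult.assoc)
  then have "rep_on G l F (sig G l f) h"
    using step.IH rep_on_mono by blast
  \<comment> \<open>As a \<open>Q\<close>-consequence, \<open>g\<close> has a representation over
    its own signature; \<open>sub\<close> is what carries it over to that of
    \<open>f\<close>.\<close>
  moreover have "rep_on G l F (sig G l f) (scalar (- c) * monom a * g * monom b)"
    using assms(2) g(1) by (intro rep_on_mult[OF _ sub]) (simp add: Q_consequence_iff_rep_on)
  ultimately have "rep_on G l F (sig G l f) (h + scalar (- c) * monom a * g * monom b)"
    by (rule rep_on_add[rotated])
  moreover have "h + scalar (- c) * monom a * g * monom b = f"
    by (simp add: h scalar_def single_uminus mult.assoc)
  ultimately show ?case by simp
qed

theorem corollary1: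
  fixes r :: "'x list rel"
    and F G :: "('x, 'k::field) free_algebra set"
    and f :: "('x, 'k) free_algebra"
    and Q :: "('v, 'e) pre_digraph"
    and l :: "'e \<Rightarrow> 'x"
  assumes "monomial_order r"
    and "G \<subseteq> ideal_gen F"
    and "reduces r G f 0"
    and "wf_digraph Q"
    and "\<forall>g\<in>G. Q_consequence Q l F g \<and> order_compatible r Q l g"
  shows "compatible Q l f \<longleftrightarrow> Q_consequence Q l F f"
  \<comment> \<open>Being a \<open>Q\<close>-consequence includes compatibility, so only the
    representation has to be supplied.\<close>
  using wf_digraph.reduces_zero_rep_on[OF assms(4,3,5)] by (simp add: Q_consequence_iff_rep_on)

end
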